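(* Dekking's result yields that there exists an abelian $9$-power free morphism $h$ over the binary alphabet $\Sigma=\{a,b\}$ with a fixed point $\Omega_1''$ such that: (i) $aaaaa$ is not a factor of $\Omega_1''$ (there are at most $4$ consecutive $a$'s in $\Omega_1''$); (ii) $bb$ is not a factor of $\Omega_1''$ (there are no two consecutive $b$'s in $\Omega_1''$); (iii) $\Omega_1''$ is abelian $9$-power free.
   Context: $\Sigma^*$ is the free monoid of finite words over $\Sigma$, with empty word $\epsilon$. A morphism $h$ over $\Sigma$ is a monoid homomorphism $h:\Sigma^*\to\Sigma^*$, extended letter by letter to infinite words; a fixed point of $h$ is an infinite word $\Omega\in\Sigma^{\mathbb{N}}$ with $h(\Omega)=\Omega$. A factor is a contiguous finite subword. The Parikh vector $\psi(u)$ of a finite word $u$ records the number of occurrences of each letter in $u$. A word $u$ (finite or infinite) is abelian $k$-power free if whenever $u=xv_1\cdots v_ky$ with $v_1,\dots,v_k$ finite words satisfying $\psi(v_1)=\cdots=\psi(v_k)$, one has $v_1=\cdots=v_k=\epsilon$. A morphism $h$ is abelian $n$-power free if $h(u)$ is abelian $n$-power free for every abelian $n$-power free word $u$. "Dekking's result", named in the claim as the tool from which the existence is obtained, is the following known sufficient criterion. Let $n>1$, let $h:\Sigma^*\to\Sigma^*$ be a morphism, $G$ a finite abelian group (written additively) and $f:\Sigma^*\to G$ a monoid morphism. Write $\operatorname{Pref}(h)$ for the set of all prefixes (including $\epsilon$ and the full word) of the words $h(\sigma)$, $\sigma\in\Sigma$, and $h(\Sigma)=\{h(\sigma):\sigma\in\Sigma\}$.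 Suppose: (D1) the frequency matrix of $h$, whose rows are the vectors $\psi(h(\sigma))$ for $\sigma\in\Sigma$, is non-singular; (D2) $f(h(\sigma))=0$ for each $\sigma\in\Sigma$; (D3) the set $f(\operatorname{Pref}(h))$ contains no arithmetic progression of length $n+1$ with non-zero common difference; (D4) for any positive integer $r$, if $f(v_1)=\cdots=f(v_r)$ with $v_i\in\operatorname{Pref}(h)\setminus h(\Sigma)$ for all $i$, then either $v_1=\cdots=v_r$ or $v_1'=\cdots=v_r'$, where $v_iv_i'=h(\sigma_{j_i})$ for some $\sigma_{j_i}\in\Sigma$. Then $h$ is an abelian $n$-power free morphism. *)

theory Defs
  imports
    "HOL-Analysis.Determinants"
    "HOL-Algebra.Group"
    "HOL-Library.Stream"
    "HOL-Library.Sublist"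
begin

text \<open>Finite words over an alphabet are lists, infinite words are streams.\<close>

definition parikh :: "'a list \<Rightarrow> 'a \<Rightarrow> nat" where
  "parikh u = (\<lambda>\<sigma>. count_list u \<sigma>)"

definition abelian_power_free :: "nat \<Rightarrow> 'a list \<Rightarrow> bool" where
  "abelian_power_free k u \<longleftrightarrow>
     (\<forall>x vs y. u = x @ concat vs @ y \<and> length vs = k \<and>
        (\<forall>v\<in>set vs. \<forall>w\<in>set vs. parikh v = parikh w)
        \<longrightarrow> (\<forall>v\<in>set vs. v = []))"

definition abelian_power_free_inf :: "nat \<Rightarrow> 'a stream \<Rightarrow> bool" where
  "abelian_power_free_inf k \<Omega> \<longleftrightarrow>
     (\<forall>x vs y. \<Omega> = x @- concat vs @- y \<and> length vs = k \<and>
        (\<forall>v\<in>set vs. \<forall>w\<in>set vs. parikh v = parikh w)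
        \<longrightarrow> (\<forall>v\<in>set vs. v = []))"

definition factor_inf :: "'a list \<Rightarrow> 'a stream \<Rightarrow> bool" where
  "factor_inf u \<Omega> \<longleftrightarrow> (\<exists>x y. \<Omega> = x @- u @- y)"

definition word_morphism :: "('a list \<Rightarrow> 'a list) \<Rightarrow> bool" where
  "word_morphism h \<longleftrightarrow> h [] = [] \<and> (\<forall>u v. h (u @ v) = h u @ h v)"

definition abelian_power_free_morphism :: "nat \<Rightarrow> ('a list \<Rightarrow> 'a list) \<Rightarrow> bool" where
  "abelian_power_free_morphism n h \<longleftrightarrow>
     word_morphism h \<and> (\<forall>u. abelian_power_free n u \<longrightarrow> abelian_power_free n (h u))"

text \<open>
  The letter-by-letter image of an infinite word under a morphism is an infinite word only if the
  images of its finite prefixes have unbounded length (a morphism may erase letters). It is then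
  the unique infinite word having all these images as prefixes.
\<close>

definition inf_image :: "('a list \<Rightarrow> 'a list) \<Rightarrow> 'a stream \<Rightarrow> 'a stream \<Rightarrow> bool" where
  "inf_image h \<Omega> \<Omega>' \<longleftrightarrow>
     (\<forall>m. \<exists>n. m \<le> length (h (stake n \<Omega>))) \<and>
     (\<forall>n. \<exists>y. \<Omega>' = h (stake n \<Omega>) @- y)"

definition fixed_point :: "('a list \<Rightarrow> 'a list) \<Rightarrow> 'a stream \<Rightarrow> bool" where
  "fixed_point h \<Omega> \<longleftrightarrow> inf_image h \<Omega> \<Omega>"

definition Pref :: "('a list \<Rightarrow> 'a list) \<Rightarrow> 'a list set" where
  "Pref h = {v. \<exists>\<sigma>. prefix v (h [\<sigma>])}"

definition frequency_matrix :: "('a::finite list \<Rightarrow> 'a list) \<Rightarrow> real^'a^'a" where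
  "frequency_matrix h = (\<chi> \<sigma> \<tau>. real (parikh (h [\<sigma>]) \<tau>))"

definition word_group_morphism :: "('g, 'm) monoid_scheme \<Rightarrow> ('a list \<Rightarrow> 'g) \<Rightarrow> bool" where
  "word_group_morphism G f \<longleftrightarrow>
     (\<forall>u. f u \<in> carrier G) \<and> f [] = \<one>\<^bsub>G\<^esub> \<and> (\<forall>u v. f (u @ v) = f u \<otimes>\<^bsub>G\<^esub> f v)"

text \<open>
  Dekking's sufficient criterion, for a finite abelian group \<open>G\<close>, which is written multiplicatively
  here: an arithmetic progression with difference \<open>d\<close> has the terms \<open>c \<otimes> d [^] i\<close>, which
  need not be distinct.
\<close>

definition dekking_criterion ::
    "nat \<Rightarrow> ('a::finite list \<Rightarrow> 'a list) \<Rightarrow> ('g, 'm) monoid_scheme \<Rightarrow> ('a list \<Rightarrow> 'g) \<Rightarrow> bool" where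
  "dekking_criterion n h G f \<longleftrightarrow>
     n > 1 \<and> word_morphism h \<and> comm_group G \<and> finite (carrier G) \<and> word_group_morphism G f \<and>
     det (frequency_matrix h) \<noteq> 0 \<and>
     (\<forall>\<sigma>. f (h [\<sigma>]) = \<one>\<^bsub>G\<^esub>) \<and>
     \<not> (\<exists>c\<in>carrier G. \<exists>d\<in>carrier G. d \<noteq> \<one>\<^bsub>G\<^esub> \<and>
          (\<forall>i<n + 1. c \<otimes>\<^bsub>G\<^esub> d [^]\<^bsub>G\<^esub> (i::nat) \<in> f ` Pref h)) \<and>
     (\<forall>r v v' j. r > 0 \<and>
        (\<forall>i<r. v i \<in> Pref h - range (\<lambda>\<sigma>. h [\<sigma>]) \<and> v i @ v' i = h [j i]) \<and>
        (\<forall>i<r. \<forall>k<r. f (v i) = f (v k))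
        \<longrightarrow> (\<forall>i<r. \<forall>k<r. v i = v k) \<or> (\<forall>i<r::nat. \<forall>k<r. v' i = v' k))"

datatype letter = La | Lb

instance letter :: finite
proof
  have "(UNIV :: letter set) = {La, Lb}"
    using letter.exhaust by blast
  then show "finite (UNIV :: letter set)"
    by (metis finite.emptyI finite.insertI)
qed

end

theory Submission
  imports Defs
begin

text \<open>
  The morphism \<open>a \<mapsto> aaaab\<close>, \<open>b \<mapsto> abababaab\<close> satisfies Dekking's criterion for \<open>f a = 1\<close>,
  \<open>f b = 7\<close> in \<open>\<int>/11\<close>: the prefixes of the two images miss the residues 7 and 10, while ten
  consecutive terms of a non-constant progression miss only one. As both images start with
  \<open>a\<close>, end with a single \<open>b\<close> and avoid \<open>bb\<close> and \<open>aaaaa\<close>, so does every image.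

  For Dekking's theorem, suppose that an image \<open>h u\<close> contains an abelian \<open>n\<close>-th power. Each of its
  \<open>n + 1\<close> cutting points lies inside some \<open>h \<sigma>\<close> and has the \<open>f\<close>-value of the prefix of \<open>h \<sigma>\<close> cut
  off there. These values form an arithmetic progression, hence are constant by (D3). By (D4)
  all cutting points can be moved left, or all right, to boundaries of letter images, without
  changing the Parikh vectors of the blocks. Since the frequency matrix is non-singular, the
  power lifts to \<open>u\<close>.
\<close>

section \<open>Parikh vectors and the frequency matrix\<close>

lemma parikh_append: "parikh (u @ v) \<sigma> = parikh u \<sigma> + parikh v \<sigma>"
  by (simp add: parikh_def)

lemma parikh_Nil: "parikh [] \<sigma> = 0"
  by (simp add: parikh_def)

lemma parikh_eq_zero: "(\<And>\<sigma>. parikh u \<sigma> = 0) \<Longrightarrow> u = []"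
  by (metis count_list_0_iff list.set_intros(1) neq_Nil_conv parikh_def)

lemma parikh_eq_imp_mset_eq: "parikh u = parikh v \<Longrightarrow> mset u = mset v"
  by (rule multiset_eqI) (metis count_mset parikh_def)

lemma word_morphism_Cons: "word_morphism h \<Longrightarrow> h (x # u) = h [x] @ h u"
  unfolding word_morphism_def by (metis append_Cons append_Nil)

lemma parikh_morphism:
  fixes h :: "'a::finite list \<Rightarrow> 'a list"
  assumes "word_morphism h"
  shows "parikh (h t) \<sigma> = (\<Sum>\<tau>\<in>UNIV. parikh t \<tau> * parikh (h [\<tau>]) \<sigma>)"
proof (induction t)
  case Nil
  then show ?case using assms by (simp add: parikh_def word_morphism_def)
next
  case (Cons x t)
  have "parikh (x # t) \<tau> * parikh (h [\<tau>]) \<sigma> =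
      (if x = \<tau> then parikh (h [\<tau>]) \<sigma> else 0) + parikh t \<tau> * parikh (h [\<tau>]) \<sigma>" for \<tau>
    by (simp add: parikh_def)
  then show ?case
    by (simp add: word_morphism_Cons[OF assms, of x t] parikh_append Cons.IH sum.distrib)
qed

text \<open>As a row vector, the Parikh vector of \<open>h u\<close> is that of \<open>u\<close>
  times the frequency matrix, and an invertible matrix can be cancelled.\<close>

lemma parikh_morphism_inj:
  fixes h :: "'a::finite list \<Rightarrow> 'a list"
  assumes h: "word_morphism h" and det: "det (frequency_matrix h) \<noteq> 0"
    and eq: "parikh (h s) = parikh (h t)"
  shows "parikh s = parikh t"
proof -
  define V where "V u = (\<chi> \<tau>. real (parikh u \<tau>))" for u :: "'a list"
  have *: "V u v* frequency_matrix h = V (h u)" for u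
    by (simp add: V_def vec_eq_iff vector_matrix_mult_def frequency_matrix_def
        parikh_morphism[OF h, of u] mult.commute)
  obtain B where "frequency_matrix h ** B = mat 1"
    using det invertible_det_nz invertible_def by metis
  then have "V u = V (h u) v* B" for u
    by (metis * vector_matrix_mul_assoc vector_matrix_mul_rid)
  moreover have "V (h s) = V (h t)" by (simp add: V_def eq)
  ultimately have "V s = V t" by metis
  then show ?thesis by (auto simp: V_def vec_eq_iff)
qed

section \<open>Morphisms from words into an abelian group\<close>

lemma word_group_morphism_Cons:
  assumes "word_group_morphism G f"
  shows "f (x # u) = f [x] \<otimes>\<^bsub>G\<^esub> f u"
  using assms unfolding word_group_morphism_def by (metis append_Cons append_Nil)

text \<open>Commutativity makes \<open>f\<close> blind to the order of letters, so the blocks of an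
  abelian power all have the same value.\<close>

lemma word_group_morphism_mset:
  assumes G: "comm_group G" and f: "word_group_morphism G f"
  shows "mset u = mset v \<Longrightarrow> f u = f v"
proof (induction u arbitrary: v)
  case Nil
  then show ?case by simp
next
  case (Cons x u)
  interpret comm_group G by (fact G)
  have f': "f u \<in> carrier G" "f (u @ v) = f u \<otimes>\<^bsub>G\<^esub> f v" for u v
    using f by (auto simp: word_group_morphism_def)
  obtain v1 v2 where v: "v = v1 @ x # v2"
    by (metis Cons.prems in_set_conv_decomp list.set_intros(1) set_mset_mset)
  have "f u = f (v1 @ v2)" using Cons v by simp
  then show ?case
    unfolding v word_group_morphism_Cons[OF f, of x u]
    by (simp add: f' word_group_morphism_Cons[OF f, of x v2] m_lcomm)
qed

lemma word_group_morphism_vanish: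
  assumes G: "comm_group G" and f: "word_group_morphism G f" and h: "word_morphism h"
    and "\<And>\<sigma>. f (h [\<sigma>]) = \<one>\<^bsub>G\<^esub>"
  shows "f (h u) = \<one>\<^bsub>G\<^esub>"
proof -
  interpret comm_group G by (fact G)
  show ?thesis
  proof (induction u)
    case Nil
    then show ?case using f h by (simp add: word_group_morphism_def word_morphism_def)
  next
    case (Cons x u)
    then show ?case
      using f assms(4) by (simp add: word_morphism_Cons[OF h, of x u] word_group_morphism_def)
  qed
qed

section \<open>Cutting points of images and Dekking's theorem\<close>

text \<open>Locates a cutting point \<open>q\<close> inside the image of a single letter
  \<open>j\<close>; a cut on a boundary gets \<open>w = []\<close>. Only for
  \<open>w \<noteq> []\<close> is \<open>j\<close> known to be the letter of \<open>u\<close> after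
  \<open>p\<close>, which is what moving the cut right requires.\<close>

lemma prefix_of_image_cases:
  assumes h: "word_morphism h" and ne: "\<And>\<sigma>. h [\<sigma>] \<noteq> []"
    and pf: "\<And>\<sigma> \<tau>. \<not> strict_prefix (h [\<sigma>]) (h [\<tau>])"
  shows "prefix q (h u) \<Longrightarrow> \<exists>p w j w'. prefix p u \<and> q = h p @ w \<and> w @ w' = h [j] \<and>
           w \<in> Pref h - range (\<lambda>\<sigma>. h [\<sigma>]) \<and> (w \<noteq> [] \<longrightarrow> prefix (p @ [j]) u)"
proof (induction u rule: rev_induct)
  case Nil
  have "[] \<in> Pref h - range (\<lambda>\<sigma>. h [\<sigma>])"
    using ne by (auto simp: Pref_def) (metis ne)
  then show ?case using Nil h by (auto simp: word_morphism_def)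
next
  case (snoc x u)
  have e: "[] \<in> Pref h - range (\<lambda>\<sigma>. h [\<sigma>])"
    using ne by (auto simp: Pref_def) (metis ne)
  have hx: "h (u @ [x]) = h u @ h [x]" using h by (simp add: word_morphism_def)
  consider "prefix q (h u)" | w where "q = h u @ w" "prefix w (h [x])"
    using snoc.prems unfolding hx prefix_append by blast
  then show ?case
  proof cases
    case 1
    then show ?thesis using snoc.IH prefix_prefix by blast
  next
    case (2 w)
    show ?thesis
    proof (cases "w = h [x]")
      case True
      then have "q = h (u @ [x]) @ []" by (simp add: 2 hx)
      moreover have "[] @ h [x] = h [x]" by simp
      ultimately show ?thesis using e by blast
    next
      case False
      then have "strict_prefix w (h [x])" using 2 by (simp add: strict_prefix_def)
      then have "w \<in> Pref h - range (\<lambda>\<sigma>. h [\<sigma>])" using 2 pf by (auto simp: Pref_def)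
      moreover obtain w' where "w @ w' = h [x]" using 2 by (auto simp: prefix_def)
      ultimately show ?thesis using 2(1) by (metis prefix_order.refl prefixI)
    qed
  qed
qed

lemma concat_consecutive_differences:
  "(\<And>i. i < m \<Longrightarrow> P (Suc i) = P i @ t i) \<Longrightarrow> P m = P 0 @ concat (map t [0..<m])"
  by (induction m) auto

text \<open>The \<open>h (P i)\<close> are the cutting points after the move to letter boundaries.
  The words between successive \<open>P i\<close> have equal Parikh vectors by
  \<open>parikh_morphism_inj\<close>, hence form an abelian power in \<open>u\<close> and are
  empty.\<close>

lemma parikh_progression_zero:
  fixes h :: "'a::finite list \<Rightarrow> 'a list"
  assumes h: "word_morphism h" and det: "det (frequency_matrix h) \<noteq> 0"
    and u: "abelian_power_free n u" and n: "n > 0"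
    and P: "\<And>i. i \<le> n \<Longrightarrow> prefix (P i) u"
    and k: "\<And>i \<sigma>. i < n \<Longrightarrow> parikh (h (P (Suc i))) \<sigma> = parikh (h (P i)) \<sigma> + k \<sigma>"
  shows "k \<sigma> = 0"
\<comment> \<open>A step that does not advance gives \<open>k\<close> plus a nonnegative vector
  equal to zero. Otherwise every step advances, as two prefixes of \<open>u\<close> are
  comparable.\<close>
proof (cases "\<exists>i<n. prefix (P (Suc i)) (P i)")
  case True
  then obtain i t where "i < n" "P i = P (Suc i) @ t" by (auto simp: prefix_def)
  then show ?thesis using k[of i \<sigma>] h by (simp add: word_morphism_def parikh_append)
next
  case False
  then have "\<forall>i. \<exists>t. i < n \<longrightarrow> P (Suc i) = P i @ t"
    using P prefix_same_cases by (metis Suc_leI less_imp_le prefix_def)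
  then obtain t where t: "\<And>i. i < n \<Longrightarrow> P (Suc i) = P i @ t i" by metis
  have ht: "parikh (h (t i)) = k" if "i < n" for i
    using k[OF that] h t[OF that] by (auto simp: word_morphism_def parikh_append)
  obtain y where "u = P n @ y" using P[of n] by (auto simp: prefix_def)
  then have "u = P 0 @ concat (map t [0..<n]) @ y"
    using concat_consecutive_differences[of n P t] t by simp
  moreover have "parikh (t i) = parikh (t j)" if "i < n" "j < n" for i j
    by (rule parikh_morphism_inj[OF h det]) (simp only: ht that)
  then have "\<forall>v\<in>set (map t [0..<n]). \<forall>w\<in>set (map t [0..<n]). parikh v = parikh w"
    by (metis (no_types, lifting) atLeastLessThan_iff imageE set_map set_upt)
  ultimately have "\<forall>v\<in>set (map t [0..<n]). v = []"
    using u unfolding abelian_power_free_def by (metis diff_zero length_map length_upt)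
  then have "t 0 = []" using n by auto
  then show ?thesis using ht[OF n] h by (auto simp: word_morphism_def parikh_Nil)
qed

text \<open>The prefix condition excludes proper prefixes of some \<open>h [\<tau>]\<close> lying in \<open>range (\<lambda>\<sigma>. h [\<sigma>])\<close>,
  about which (D4) says nothing.\<close>

theorem dekking:
  fixes h :: "'a::finite list \<Rightarrow> 'a list"
  assumes crit: "dekking_criterion n h G f"
    and pf: "\<And>\<sigma> \<tau>. \<not> strict_prefix (h [\<sigma>]) (h [\<tau>])"
  shows "abelian_power_free_morphism n h"
proof -
  have n: "n > 1" and h: "word_morphism h" and G: "comm_group G"
    and f: "word_group_morphism G f" and det: "det (frequency_matrix h) \<noteq> 0"
    and fh: "\<And>\<sigma>. f (h [\<sigma>]) = \<one>\<^bsub>G\<^esub>"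
    and D3: "\<And>c d. c \<in> carrier G \<Longrightarrow> d \<in> carrier G \<Longrightarrow>
          (\<And>i. i < n + 1 \<Longrightarrow> c \<otimes>\<^bsub>G\<^esub> d [^]\<^bsub>G\<^esub> (i::nat) \<in> f ` Pref h) \<Longrightarrow> d = \<one>\<^bsub>G\<^esub>"
    and D4: "\<And>r v v' j. r > 0 \<Longrightarrow>
        (\<forall>i<r. v i \<in> Pref h - range (\<lambda>\<sigma>. h [\<sigma>]) \<and> v i @ v' i = h [j i]) \<Longrightarrow>
        (\<forall>i<r. \<forall>k<r. f (v i) = f (v k)) \<Longrightarrow>
        (\<forall>i<r. \<forall>k<r. v i = v k) \<or> (\<forall>i<r::nat. \<forall>k<r. v' i = v' k)"
    using crit unfolding dekking_criterion_def by - (blast+)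
  interpret comm_group G by (fact G)
  have fc: "f u \<in> carrier G" and fNil: "f [] = \<one>\<^bsub>G\<^esub>"
    and fapp: "f (u @ v) = f u \<otimes>\<^bsub>G\<^esub> f v" for u v
    using f by (auto simp: word_group_morphism_def)
  have happ: "h (u @ v) = h u @ h v" for u v using h by (simp add: word_morphism_def)
  \<comment> \<open>An erased letter would have the same image as the empty word, against
    injectivity on Parikh vectors.\<close>
  have ne: "h [\<sigma>] \<noteq> []" for \<sigma>
  proof
    assume "h [\<sigma>] = []"
    then have "parikh (h [\<sigma>]) = parikh (h [])" using h by (simp add: word_morphism_def)
    from parikh_morphism_inj[OF h det this] have "parikh [\<sigma>] \<sigma> = parikh [] \<sigma>" by simp
    then show False by (simp add: parikh_def)
  qed
  have e: "[] \<in> Pref h - range (\<lambda>\<sigma>. h [\<sigma>])"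
    using ne by (auto simp: Pref_def) (metis ne)
  \<comment> \<open>(D4) is applied to \<open>w\<close> and \<open>[]\<close> as prefixes of the
    same \<open>h [j]\<close>: equal prefixes and equal suffixes both force
    \<open>w = []\<close>.\<close>
  have class_one: "w = []"
    if "w \<in> Pref h - range (\<lambda>\<sigma>. h [\<sigma>])" "w @ w' = h [j]" "f w = \<one>\<^bsub>G\<^esub>" for w w' j
    using D4[of 2 "\<lambda>i. if i = 0 then w else []" "\<lambda>i. if i = 0 then w' else h [j]" "\<lambda>_. j"]
      that e fNil by (auto simp: less_2_cases_iff)
  have "abelian_power_free n (h u)" if u: "abelian_power_free n u" for u
    unfolding abelian_power_free_def
  proof (intro allI impI; elim conjE)
    fix x vs y
    assume hu: "h u = x @ concat vs @ y" and len: "length vs = n"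
      and par: "\<forall>v\<in>set vs. \<forall>w\<in>set vs. parikh v = parikh w"
    \<comment> \<open>The cutting points, for \<open>i\<close> from 0 to \<open>n\<close>.\<close>
    define q where "q i = x @ concat (take i vs)" for i
    have q_Suc: "q (Suc i) = q i @ vs ! i" if "i < n" for i
      using that len by (simp add: q_def take_Suc_conv_app_nth)
    have "h u = q i @ concat (drop i vs) @ y" for i
      unfolding hu q_def by (metis append.assoc append_take_drop_id concat_append)
    then have "prefix (q i) (h u)" for i by (metis prefixI)
    then have "\<forall>i. \<exists>p w j w'. prefix p u \<and> q i = h p @ w \<and> w @ w' = h [j] \<and>
           w \<in> Pref h - range (\<lambda>\<sigma>. h [\<sigma>]) \<and> (w \<noteq> [] \<longrightarrow> prefix (p @ [j]) u)"
      using prefix_of_image_cases[OF h ne pf] by blast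
    then obtain p w j w' where dec: "\<forall>i. prefix (p i) u \<and> q i = h (p i) @ w i \<and>
           w i @ w' i = h [j i] \<and> w i \<in> Pref h - range (\<lambda>\<sigma>. h [\<sigma>]) \<and>
           (w i \<noteq> [] \<longrightarrow> prefix (p i @ [j i]) u)"
      unfolding choice_iff by blast
    then have p: "prefix (p i) u" and q: "q i = h (p i) @ w i" and ww: "w i @ w' i = h [j i]"
      and w: "w i \<in> Pref h - range (\<lambda>\<sigma>. h [\<sigma>])"
      and pj: "w i \<noteq> [] \<Longrightarrow> prefix (p i @ [j i]) u" for i
      by blast+
    define k where "k = parikh (vs ! 0)"
    have k: "parikh (vs ! i) = k" if "i < n" for i
      using par that len n unfolding k_def by (metis nth_mem order.strict_trans zero_less_one)
    define d where "d = f (vs ! 0)"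
    have d: "f (vs ! i) = d" if "i < n" for i
      unfolding d_def using k[OF that]
      by (intro word_group_morphism_mset[OF G f] parikh_eq_imp_mset_eq) (simp add: k_def)
    have fq: "f (q i) = f (w i)" for i
      by (simp add: q fapp word_group_morphism_vanish[OF G f h fh] fc)
    have ap: "f (w i) = f (w 0) \<otimes>\<^bsub>G\<^esub> d [^]\<^bsub>G\<^esub> i" if "i \<le> n" for i
      using that
    proof (induction i)
      case 0
      then show ?case by (simp add: fc)
    next
      case (Suc i)
      have "f (w (Suc i)) = f (w i) \<otimes>\<^bsub>G\<^esub> d"
        using Suc.prems by (simp add: fq[symmetric] q_Suc fapp d)
      then show ?case using Suc by (simp add: fc d_def m_assoc)
    qed
    have "d = \<one>\<^bsub>G\<^esub>"
    proof (rule D3)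
      show "f (w 0) \<otimes>\<^bsub>G\<^esub> d [^]\<^bsub>G\<^esub> i \<in> f ` Pref h" if "i < n + 1" for i
        using ap[of i] w[of i] that by (metis DiffD1 Suc_eq_plus1 imageI less_Suc_eq_le)
    qed (simp_all add: fc d_def)
    then have feq: "f (w i) = f (w 0)" if "i \<le> n" for i using ap[OF that] by (simp add: fc)
    have "(\<forall>i<n+1. \<forall>k<n+1. w i = w k) \<or> (\<forall>i<n+1. \<forall>k<n+1. w' i = w' k)"
    proof (rule D4)
      show "\<forall>i<n+1. \<forall>k<n+1. f (w i) = f (w k)" using feq by (metis Suc_eq_plus1 less_Suc_eq_le)
    qed (use w ww in auto)
    \<comment> \<open>Moving right is sound only if every cut is strictly inside an image. If some
      \<open>w i\<close> is empty, the common value is the identity, so \<open>class_one\<close>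
      makes all of them empty and the first case applies.\<close>
    then consider (eq) "\<And>i. i \<le> n \<Longrightarrow> w i = w 0"
      | (eq') "\<And>i. i \<le> n \<Longrightarrow> w' i = w' 0" "\<And>i. i \<le> n \<Longrightarrow> w i \<noteq> []"
    proof (cases "\<exists>i\<le>n. w i = []")
      case True
      then have "f (w i) = \<one>\<^bsub>G\<^esub>" if "i \<le> n" for i using feq that fNil by metis
      then have "w i = []" if "i \<le> n" for i using class_one w ww that by blast
      then show ?thesis using that(1) by simp
    next
      case False
      then show ?thesis using that by (metis Suc_eq_plus1 \<open>_ \<or> _\<close> less_Suc_eq_le zero_le)
    qed
    then have k0: "k \<sigma> = 0" for \<sigma>
    proof cases
      case eq
      have "parikh (h (p (Suc i))) \<tau> = parikh (h (p i)) \<tau> + k \<tau>" if "i < n" for i \<tau>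
      proof -
        \<comment> \<open>Both sides contain \<open>w 0\<close>, which cancels in Parikh vectors
          although it stands at different places.\<close>
        have "h (p (Suc i)) @ w 0 = h (p i) @ w 0 @ vs ! i"
          using q_Suc[OF that] q[of i] q[of "Suc i"] eq[of i] eq[of "Suc i"] that by simp
        from arg_cong[OF this, of "\<lambda>u. parikh u \<tau>"] show ?thesis
          using k[OF that] by (simp add: parikh_append)
      qed
      moreover have "n > 0" using n by simp
      ultimately show ?thesis by (intro parikh_progression_zero[OF h det u _ p])
    next
      case eq'
      \<comment> \<open>The cut moves right to the end of the image containing it, which appends the
        common suffix \<open>w' 0\<close>.\<close>
      define P where "P i = p i @ [j i]" for i
      have hP: "h (P i) = q i @ w' 0" if "i \<le> n" for i
        using ww[of i] q[of i] eq'(1)[OF that] by (simp add: P_def happ flip: ww)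
      have "parikh (h (P (Suc i))) \<tau> = parikh (h (P i)) \<tau> + k \<tau>" if "i < n" for i \<tau>
        using that k[OF that] by (simp add: hP q_Suc parikh_append)
      moreover have "prefix (P i) u" if "i \<le> n" for i
        using pj eq'(2) that by (simp add: P_def)
      moreover have "n > 0" using n by simp
      ultimately show ?thesis by (intro parikh_progression_zero[OF h det u])
    qed
    show "\<forall>v\<in>set vs. v = []"
      using k k0 len parikh_eq_zero by (metis in_set_conv_nth)
  qed
  then show ?thesis using h by (simp add: abelian_power_free_morphism_def)
qed

section \<open>Short words, iterates and fixed points\<close>

text \<open>Blocks with equal Parikh vectors are all empty or all nonempty, and \<open>n\<close>
  nonempty blocks take at least \<open>n\<close> letters. This supplies the seed of the
  iteration.\<close>

lemma abelian_power_free_short: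
  assumes "length u < n"
  shows "abelian_power_free n u"
  unfolding abelian_power_free_def
proof (intro allI impI; elim conjE; rule ccontr)
  fix x vs y
  assume u: "u = x @ concat vs @ y" and len: "length vs = n"
    and par: "\<forall>v\<in>set vs. \<forall>w\<in>set vs. parikh v = parikh w"
    and "\<not> (\<forall>v\<in>set vs. v = [])"
  then have "\<forall>v\<in>set vs. v \<noteq> []" by (metis parikh_Nil parikh_eq_zero)
  then have "length vs \<le> length (concat vs)"
    by (induction vs) (auto simp: Suc_le_eq add_strict_increasing)
  then show False using assms u len by simp
qed

lemma abelian_power_free_funpow:
  assumes "abelian_power_free_morphism n h" "abelian_power_free n u"
  shows "abelian_power_free n ((h ^^ k) u)"
  using assms by (induction k) (auto simp: abelian_power_free_morphism_def)

lemma word_morphism_funpow: "word_morphism h \<Longrightarrow> word_morphism (h ^^ k)"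
  by (induction k) (auto simp: word_morphism_def)

lemma length_le_nonerasing:
  assumes h: "word_morphism h" and ne: "\<And>\<sigma>. h [\<sigma>] \<noteq> []"
  shows "length u \<le> length (h u)"
proof (induction u)
  case (Cons x u)
  have "length (h [x]) \<ge> 1" using ne[of x] by (simp add: Suc_le_eq)
  with Cons show ?case by (simp add: word_morphism_Cons[OF h, of x u])
qed simp

text \<open>As \<open>h [a]\<close> starts with \<open>a\<close>, each iterate on \<open>[a]\<close>
  is a prefix of the next; it is a proper one because \<open>s\<close> is nonempty and no letter is
  erased. The limit is the fixed point.\<close>

lemma fixed_point_exists:
  assumes h: "word_morphism h" and ne: "\<And>\<sigma>. h [\<sigma>] \<noteq> []" and a: "h [a] = a # s" and s: "s \<noteq> []"
  obtains \<Omega> where "fixed_point h \<Omega>" "\<And>m. prefix (stake m \<Omega>) ((h ^^ m) [a])"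
proof -
  define W where "W k = (h ^^ k) [a]" for k
  have W_Suc: "W (Suc k) = W k @ (h ^^ k) s" for k
    using word_morphism_funpow[OF h, of k] a
    by (simp add: W_def funpow_Suc_right word_morphism_Cons[of _ a s] del: funpow.simps)
  have len: "length u \<le> length ((h ^^ k) u)" for k u
    by (induction k) (auto intro: order_trans length_le_nonerasing[OF h ne])
  have lenW: "k < length (W k)" for k
  proof (induction k)
    case (Suc k)
    have "0 < length ((h ^^ k) s)" using len[of s k] s by auto
    with Suc show ?case unfolding W_Suc length_append by linarith
  qed (simp add: W_def)
  have mono: "prefix (W k) (W l)" if "k \<le> l" for k l
    using that by (induction l rule: dec_induct) (auto simp: W_Suc)
  have nth: "W k ! i = W l ! i" if "i < length (W k)" "i < length (W l)" for i k l
    using mono[of k l] mono[of l k] that nat_le_linear[of k l]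
    by (auto simp: prefix_def nth_append)
  \<comment> \<open>A diagonal choice: \<open>lenW\<close> ensures that \<open>W n\<close> has a
    letter at index \<open>n\<close>, and all longer iterates agree there.\<close>
  define \<Omega> where "\<Omega> = smap (\<lambda>n. W n ! n) nats"
  have stake: "stake (length (W k)) \<Omega> = W k" for k
    by (rule nth_equalityI) (auto simp: \<Omega>_def intro: nth lenW)
  have pre: "prefix (stake m \<Omega>) (W m)" for m
  proof -
    have "stake m \<Omega> = take m (stake (length (W m)) \<Omega>)"
      using lenW[of m] by (simp add: take_stake min_def)
    then show ?thesis by (metis stake take_is_prefix)
  qed
  have "inf_image h \<Omega> \<Omega>"
    unfolding inf_image_def
  proof (intro conjI allI)
    show "\<exists>n. m \<le> length (h (stake n \<Omega>))" for m
      using length_le_nonerasing[OF h ne, of "stake m \<Omega>"] by auto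
    show "\<exists>y. \<Omega> = h (stake n \<Omega>) @- y" for n
    proof -
      obtain z where "W n = stake n \<Omega> @ z" using pre by (metis prefix_def)
      then have "W (Suc n) = h (stake n \<Omega>) @ h z" using h by (simp add: W_def word_morphism_def)
      moreover have "\<Omega> = W (Suc n) @- sdrop (length (W (Suc n))) \<Omega>"
        by (metis stake stake_sdrop)
      ultimately show ?thesis by (metis shift_append)
    qed
  qed
  then show thesis using that pre by (simp add: fixed_point_def W_def)
qed

section \<open>The concrete morphism and its weights modulo 11\<close>

fun letter_image :: "letter \<Rightarrow> letter list" where
  "letter_image La = [La, La, La, La, Lb]"
| "letter_image Lb = [La, Lb, La, Lb, La, Lb, La, La, Lb]"

definition phi :: "letter list \<Rightarrow> letter list" where
  "phi u = concat (map letter_image u)"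

definition Z11 :: "nat monoid" where
  "Z11 = \<lparr>carrier = {..<11}, mult = \<lambda>x y. (x + y) mod 11, one = 0\<rparr>"

text \<open>The letter weights 1 and 7 annihilate both images: 4 + 7 = 11 and 5 + 4 * 7 =
  33.\<close>

definition weight :: "letter list \<Rightarrow> nat" where
  "weight u = (parikh u La + 7 * parikh u Lb) mod 11"

lemma UNIV_letter: "(UNIV :: letter set) = {La, Lb}"
  using letter.exhaust by blast

lemma letter_all: "(\<forall>\<sigma>. P \<sigma>) \<longleftrightarrow> P La \<and> P Lb"
  by (metis letter.exhaust)

lemma letter_ex: "(\<exists>\<sigma>. P \<sigma>) \<longleftrightarrow> P La \<or> P Lb"
  by (metis letter.exhaust)

lemma word_morphism_phi: "word_morphism phi"
  by (simp add: word_morphism_def phi_def)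

lemma phi_letter [simp]: "phi [\<sigma>] = letter_image \<sigma>"
  by (simp add: phi_def)

lemma comm_group_Z11: "comm_group Z11"
proof (rule comm_groupI)
  fix x assume "x \<in> carrier Z11"
  then show "\<exists>y\<in>carrier Z11. y \<otimes>\<^bsub>Z11\<^esub> x = \<one>\<^bsub>Z11\<^esub>"
    \<comment> \<open>The outer \<open>mod 11\<close> matters for \<open>x = 0\<close>, since 11 is
      outside the carrier.\<close>
    by (intro bexI[of _ "(11 - x) mod 11"]) (auto simp: Z11_def mod_simps)
qed (auto simp: Z11_def mod_simps ac_simps)

lemma pow_Z11: "d [^]\<^bsub>Z11\<^esub> (i::nat) = (i * d) mod 11"
proof -
  interpret comm_group Z11 by (fact comm_group_Z11)
  show ?thesis
    by (induction i) (auto simp: nat_pow_Suc, auto simp: Z11_def mod_simps algebra_simps)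
qed

lemma word_group_morphism_weight: "word_group_morphism Z11 weight"
proof -
  have "weight (u @ v) = (weight u + weight v) mod 11" for u v
    unfolding weight_def parikh_append mod_add_eq by (rule arg_cong) simp
  then show ?thesis
    by (auto simp: word_group_morphism_def Z11_def weight_def parikh_Nil)
qed

lemma det_frequency_matrix_phi: "det (frequency_matrix phi) \<noteq> 0"
proof -
  have "x = 0" if "frequency_matrix phi *v x = 0" for x
  proof -
    \<comment> \<open>The rows of the matrix are (4, 1) and (5, 4), of determinant 11;
      nonsingularity is obtained from the trivial kernel.\<close>
    have "4 * x $ La + x $ Lb = 0" "5 * x $ La + 4 * x $ Lb = 0"
      using that unfolding vec_eq_iff letter_all
      by (simp_all add: matrix_vector_mult_def UNIV_letter frequency_matrix_def parikh_def)
    then show ?thesis unfolding vec_eq_iff letter_all by simp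
  qed
  then show ?thesis
    by (metis invertible_det_nz invertible_left_inverse matrix_left_invertible_ker)
qed

text \<open>With growing prefix the weights run through 0, 1, 2, 3, 4, 0 for \<open>La\<close> and
  0, 1, 8, 9, 5, 6, 2, 3, 4, 0 for \<open>Lb\<close>.\<close>

lemma weight_Pref: "weight ` Pref phi \<subseteq> {..<11} - {7, 10}"
  by (auto simp: Pref_def letter_ex prefix_Cons weight_def parikh_def)

text \<open>The residues 2, 3 and 4 are those attained by two different proper prefixes; there the
  corresponding suffixes agree.\<close>

lemma split_unique:
  assumes "v @ v' = phi [\<sigma>]" "v \<notin> range (\<lambda>\<sigma>. phi [\<sigma>])"
    and "w @ w' = phi [\<tau>]" "w \<notin> range (\<lambda>\<sigma>. phi [\<sigma>])"
    and "weight v = weight w"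
  shows "if weight v \<in> {2, 3, 4} then v' = w' else v = w"
proof -
  \<comment> \<open>All splits of the two images with nonempty second part, as a list, so that the
    claim becomes a finite evaluation.\<close>
  define S where "S = [(take i u, drop i u).
      u \<leftarrow> [letter_image La, letter_image Lb], i \<leftarrow> [0..<length u]]"
  have *: "(x, x') \<in> set S" if "x @ x' = phi [\<rho>]" "x \<notin> range (\<lambda>\<sigma>. phi [\<sigma>])" for x x' \<rho>
  proof -
    have "x' \<noteq> []" using that by auto
    then have "length x < length (letter_image \<rho>)"
      using that(1)
      by (metis phi_letter length_append length_greater_0_conv less_add_same_cancel1)
    moreover have "x = take (length x) (letter_image \<rho>)" "x' = drop (length x) (letter_image \<rho>)"
      using that(1) by (metis phi_letter append_eq_conv_conj)+
    ultimately show ?thesis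
      unfolding S_def by (cases \<rho>) (force simp del: letter_image.simps)+
  qed
  have "\<forall>(x, x')\<in>set S. \<forall>(y, y')\<in>set S. weight x = weight y \<longrightarrow>
      (if weight x \<in> set [2, 3, 4] then x' = y' else x = y)"
    unfolding S_def by code_simp
  then show ?thesis using *[OF assms(1,2)] *[OF assms(3,4)] assms(5) by fastforce
qed

text \<open>Since 11 is prime, ten terms with nonzero difference are distinct and omit one residue
  only, so 7 or 10 occurs. The proof evaluates all pairs \<open>c\<close>, \<open>d\<close>.\<close>

lemma no_progression:
  assumes "c < 11" "d < 11" "\<And>i. i < 10 \<Longrightarrow> (c + i * d) mod 11 \<in> {..<11} - {7, 10}"
  shows "d = (0::nat)"
proof (rule ccontr)
  assume "d \<noteq> 0"
  moreover have "\<forall>c\<in>set [0..<11]. \<forall>d\<in>set [1..<11]. \<exists>i\<in>set [0..<10].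
      (c + i * d) mod 11 \<in> set [7, 10::nat]"
    by code_simp
  ultimately obtain i where "i < 10" "(c + i * d) mod 11 \<in> {7, 10}" using assms(1,2)
    by fastforce
  with assms(3) show False by blast
qed

lemma dekking_criterion_phi: "dekking_criterion 9 phi Z11 weight"
  unfolding dekking_criterion_def
proof (intro conjI)
  show "finite (carrier Z11)" by (simp add: Z11_def)
  show "\<forall>\<sigma>. weight (phi [\<sigma>]) = \<one>\<^bsub>Z11\<^esub>"
    by (simp add: letter_all weight_def parikh_def Z11_def)
  show "\<not> (\<exists>c\<in>carrier Z11. \<exists>d\<in>carrier Z11. d \<noteq> \<one>\<^bsub>Z11\<^esub> \<and>
          (\<forall>i<9 + 1. c \<otimes>\<^bsub>Z11\<^esub> d [^]\<^bsub>Z11\<^esub> (i::nat) \<in> weight ` Pref phi))"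
  proof (intro notI; elim bexE conjE)
    fix c d
    assume "c \<in> carrier Z11" "d \<in> carrier Z11" "d \<noteq> \<one>\<^bsub>Z11\<^esub>"
      and *: "\<forall>i<9 + 1. c \<otimes>\<^bsub>Z11\<^esub> d [^]\<^bsub>Z11\<^esub> (i::nat) \<in> weight ` Pref phi"
    moreover have "(c + i * d) mod 11 \<in> {..<11} - {7, 10}" if "i < 10" for i
    proof -
      have "c \<otimes>\<^bsub>Z11\<^esub> d [^]\<^bsub>Z11\<^esub> i \<in> {..<11} - {7, 10}"
        using * that weight_Pref by auto
      then show ?thesis unfolding pow_Z11 by (simp add: Z11_def mod_simps)
    qed
    ultimately show False using no_progression[of c d] by (simp add: Z11_def)
  qed
  show "\<forall>r v v' j. r > 0 \<and>
        (\<forall>i<r. v i \<in> Pref phi - range (\<lambda>\<sigma>. phi [\<sigma>]) \<and> v i @ v' i = phi [j i]) \<and>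
        (\<forall>i<r. \<forall>k<r. weight (v i) = weight (v k))
        \<longrightarrow> (\<forall>i<r. \<forall>k<r. v i = v k) \<or> (\<forall>i<r::nat. \<forall>k<r. v' i = v' k)"
  proof (intro allI impI; elim conjE)
    fix r :: nat and v v' :: "nat \<Rightarrow> letter list" and j :: "nat \<Rightarrow> letter"
    assume v: "\<forall>i<r. v i \<in> Pref phi - range (\<lambda>\<sigma>. phi [\<sigma>]) \<and> v i @ v' i = phi [j i]"
      and eq: "\<forall>i<r. \<forall>k<r. weight (v i) = weight (v k)"
    have *: "if weight (v i) \<in> {2, 3, 4} then v' i = v' k else v i = v k" if "i < r" "k < r" for i k
      using v eq that by (intro split_unique[of _ _ "j i" _ _ "j k"]) blast+
    show "(\<forall>i<r. \<forall>k<r. v i = v k) \<or> (\<forall>i<r. \<forall>k<r. v' i = v' k)"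
    \<comment> \<open>All weights equal that of \<open>v 0\<close>, so the same alternative of
      \<open>split_unique\<close> holds for every pair.\<close>
    proof (cases "weight (v 0) \<in> {2, 3, 4}")
      case True
      then have "v' i = v' k" if "i < r" "k < r" for i k
        using *[OF that] eq that by (metis bot_nat_0.not_eq_extremum less_zeroE)
      then show ?thesis by blast
    next
      case False
      then have "v i = v k" if "i < r" "k < r" for i k
        using *[OF that] eq that by (metis bot_nat_0.not_eq_extremum less_zeroE)
      then show ?thesis by blast
    qed
  qed
qed (simp_all add: word_morphism_phi comm_group_Z11 word_group_morphism_weight
    det_frequency_matrix_phi)

section \<open>Forbidden factors and the fixed point of \<open>phi\<close>\<close>

lemma phi_no_aaaaa: "\<not> sublist [La, La, La, La, La] (phi u)"
proof (induction u)
  case (Cons x u)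
  then show ?case by (cases x) (auto simp: phi_def sublist_Cons_right)
qed (simp add: phi_def)

text \<open>The leading \<open>Lb\<close> strengthens the induction: it stands for the last letter
  of the preceding image, so that boundaries are covered too.\<close>

lemma phi_no_bb: "\<not> sublist [Lb, Lb] (Lb # phi u)"
proof (induction u)
  case (Cons x u)
  then show ?case by (cases x) (auto simp: phi_def sublist_Cons_right)
qed (simp add: phi_def sublist_Cons_right)

theorem theorem2p21:
  shows "\<exists>(h :: letter list \<Rightarrow> letter list) (\<Omega> :: letter stream).
           word_morphism h \<and>
           (\<exists>(G :: nat monoid) f. dekking_criterion 9 h G f) \<and>
           abelian_power_free_morphism 9 h \<and>
           fixed_point h \<Omega> \<and>
           \<not> factor_inf [La, La, La, La, La] \<Omega> \<and>
           \<not> factor_inf [Lb, Lb] \<Omega> \<and>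
           abelian_power_free_inf 9 \<Omega>"
proof -
  have ne: "phi [\<sigma>] \<noteq> []" for \<sigma> by (cases \<sigma>) auto
  have "\<not> strict_prefix (phi [\<sigma>]) (phi [\<tau>])" for \<sigma> \<tau>
    by (cases \<sigma>; cases \<tau>) auto
  then have free: "abelian_power_free_morphism 9 phi"
    using dekking[OF dekking_criterion_phi] by blast
  obtain \<Omega> where fixed: "fixed_point phi \<Omega>"
    and pre: "\<And>m. prefix (stake m \<Omega>) ((phi ^^ m) [La])"
    using fixed_point_exists[OF word_morphism_phi ne, of La "[La, La, La, Lb]"] by auto
  \<comment> \<open>Every finite prefix of \<open>\<Omega>\<close> is a prefix of an iterate, which
    reduces the claims on \<open>\<Omega>\<close> to finite words.\<close>
  have factor: "\<exists>m z. (phi ^^ m) [La] = x @ u @ z" if "\<Omega> = x @- u @- y" for x u y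
  proof -
    have "stake (length (x @ u)) \<Omega> = x @ u"
      unfolding that by (simp add: stake_shift)
    then show ?thesis using pre[of "length (x @ u)"] by (auto simp: prefix_def)
  qed
  have no_factor: "\<not> factor_inf u \<Omega>"
    if "\<not> sublist u [La]" "\<And>w. \<not> sublist u (phi w)" for u
  proof
    assume "factor_inf u \<Omega>"
    then obtain m where "sublist u ((phi ^^ m) [La])"
      unfolding factor_inf_def using factor by (metis sublist_appendI)
    \<comment> \<open>For \<open>m = 0\<close> the word is \<open>[La]\<close>; every later iterate
      is an image under \<open>phi\<close>.\<close>
    then show False using that by (cases m) auto
  qed
  have "\<not> factor_inf [La, La, La, La, La] \<Omega>"
    by (rule no_factor) (simp_all add: phi_no_aaaaa sublist_Cons_right)
  moreover have "\<not> factor_inf [Lb, Lb] \<Omega>"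
    using phi_no_bb by (intro no_factor) (auto simp: sublist_Cons_right)
  moreover have "abelian_power_free_inf 9 \<Omega>"
    unfolding abelian_power_free_inf_def
  proof (intro allI impI; elim conjE)
    fix x vs y
    assume "\<Omega> = x @- concat vs @- y" and vs: "length vs = 9"
      "\<forall>v\<in>set vs. \<forall>w\<in>set vs. parikh v = parikh w"
    then obtain m z where "(phi ^^ m) [La] = x @ concat vs @ z" using factor by blast
    moreover have "abelian_power_free 9 ((phi ^^ m) [La])"
      by (intro abelian_power_free_funpow[OF free] abelian_power_free_short) simp
    ultimately show "\<forall>v\<in>set vs. v = []"
      using vs unfolding abelian_power_free_def by metis
  qed
  ultimately show ?thesis
    using word_morphism_phi dekking_criterion_phi free fixed by blast
qed

end
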